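(* Let $(f(i,j))_{i,j\in\mathbb{Z}}$ be independent and identically distributed $\mathbb{Z}\cup\{-\infty\}$-valued random variables on a probability space $(\Omega,\mathcal{F},\mathbb{P})$, and let $Z_0,Z_1,Z_2,\dots$ be independent random variables, each having the same distribution as $f(0,0)$. If, for some $F\in\mathbb{Z}$, $$\mathbb{E}\Big(\sup_{m\in\mathbb{N}_0}(Z_m-m)\Big)=\mathbb{E}\big(Z_0\vee(-1+Z_1)\vee(-2+Z_2)\vee\dots\big)>F,$$ then, almost surely, there exists a function $v:\mathbb{Z}\to\mathbb{N}_0$ such that $$\Delta_1 v(i)\le f(i,v(i))-F\quad\text{for all } i\in\mathbb{Z}.$$
   Context: $\mathbb{N}_0=\{0,1,2,\dots\}$ and $a\vee b=\max\{a,b\}$. For $v:\mathbb{Z}\to\mathbb{Z}$, the discrete Laplacian is $\Delta_1 v(i)=v(i+1)+v(i-1)-2v(i)$. $\mathbb{E}$ is the expected value of a (possibly extended real-valued) random variable, whenever it is defined. The usual order on $\mathbb{Z}\cup\{-\infty\}$ is used, with $-\infty-F=-\infty$, so the inequality fails when $f(i,v(i))=-\infty$. The function $v$ is allowed to depend on the realization $\omega\in\Omega$. *)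

theory Defs
  imports "HOL-Probability.Probability"
begin

definition int_minf :: "ereal set" where
  "int_minf = insert (-\<infinity>) (range (\<lambda>k::int. ereal (real_of_int k)))"

definition laplacian1 :: "(int \<Rightarrow> int) \<Rightarrow> int \<Rightarrow> int" where
  "laplacian1 v i = v (i + 1) + v (i - 1) - 2 * v i"

text \<open>
  The expected value of an extended real-valued random variable is the difference of the
  integrals of its positive and negative parts (\<^const>\<open>e2ennreal\<close> truncates negative
  values to 0). It is defined iff at least one of the two is finite. Definedness has to be
  required separately, because \<open>\<infinity> - \<infinity> = \<infinity>\<close> holds for the type \<^typ>\<open>ereal\<close>.
\<close>

definition ext_expectation_defined :: "'a measure \<Rightarrow> ('a \<Rightarrow> ereal) \<Rightarrow> bool" where
  "ext_expectation_defined M X \<longleftrightarrow>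
     X \<in> borel_measurable M \<and>
     ((\<integral>\<^sup>+ \<omega>. e2ennreal (X \<omega>) \<partial>M) < \<infinity> \<or> (\<integral>\<^sup>+ \<omega>. e2ennreal (- X \<omega>) \<partial>M) < \<infinity>)"

definition ext_expectation :: "'a measure \<Rightarrow> ('a \<Rightarrow> ereal) \<Rightarrow> ereal" where
  "ext_expectation M X =
     enn2ereal (\<integral>\<^sup>+ \<omega>. e2ennreal (X \<omega>) \<partial>M) - enn2ereal (\<integral>\<^sup>+ \<omega>. e2ennreal (- X \<omega>) \<partial>M)"

end

theory Submission
  imports Defs
begin

text \<open>
  Build \<open>v\<close> column by column, to the right and to the left of a starting point \<open>(0, h)\<close>. If the
  previous height and slope propose the height \<open>u\<close> in column \<open>i\<close>, then choosing the height \<open>u - m\<close>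
  costs \<open>m\<close> in the incoming slope and allows the outgoing slope to exceed the incoming one by
  \<open>f i (u - m) - F\<close>. With the best choice of \<open>m\<close> the slope increases by \<open>sup_m (f i (u - m) - m) - F\<close>.
  Each column is fresh, so the slope is a random walk with positive drift, and the heights
  eventually grow quadratically. They stay nonnegative with high probability if \<open>h\<close> is large, and
  some large \<open>h\<close> satisfies \<open>f 0 h \<ge> c\<close>, which permits gluing the two halves at column \<open>0\<close>.

  To control the walk, \<open>f\<close> is replaced by \<open>min f L\<close>, with \<open>L\<close> so large that the drift stays positive.
  The step is then bounded above and has a geometric lower tail (wait for the first \<open>m\<close> with
  \<open>f i (u - m) \<ge> c\<close>), so it has small exponential moments, and a Chernoff bound applies.
\<close>

section \<open>Adaptively chosen products\<close>

text \<open>Kept as a deterministic function of the input sequence, so that it serves both pathwise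
  estimates and probability bounds. The state at time \<open>n\<close> reads only inputs before
  \<open>n\<close>, which is the source of its independence from \<open>\<xi> n\<close>.\<close>

primrec adaptive_state :: "('s \<Rightarrow> 'c \<Rightarrow> 's) \<Rightarrow> 's \<Rightarrow> (nat \<Rightarrow> 'c) \<Rightarrow> nat \<Rightarrow> 's" where
  "adaptive_state T x \<xi> 0 = x"
| "adaptive_state T x \<xi> (Suc n) = T (adaptive_state T x \<xi> n) (\<xi> n)"

lemma adaptive_state_cong:
  "(\<And>k. k < n \<Longrightarrow> \<xi> k = \<xi>' k) \<Longrightarrow> adaptive_state T x \<xi> n = adaptive_state T x \<xi>' n"
  by (induction n) auto

text \<open>Countability of the state space lets one freeze the state and treat the next step as a
  function of the fresh input alone. The index set \<open>A\<close> is left open because both finite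
  prefixes and the full sequence occur.\<close>

lemma measurable_adaptive_state:
  fixes T :: "'s::countable \<Rightarrow> 'c \<Rightarrow> 's"
  assumes T: "\<And>y. T y \<in> measurable C (count_space UNIV)"
  shows "{..<n} \<subseteq> A \<Longrightarrow> (\<lambda>\<xi>. adaptive_state T x \<xi> n) \<in> measurable (PiM A (\<lambda>_. C)) (count_space UNIV)"
proof (induction n)
  case 0
  then show ?case by simp
next
  case (Suc n)
  have "(\<lambda>\<xi>. T y (\<xi> n)) \<in> measurable (PiM A (\<lambda>_. C)) (count_space UNIV)" for y
    by (rule measurable_compose[OF _ T]) (use Suc.prems in \<open>auto intro: measurable_component_singleton\<close>)
  then have "(\<lambda>\<xi>. T (adaptive_state T x \<xi> n) (\<xi> n)) \<in> measurable (PiM A (\<lambda>_. C)) (count_space UNIV)"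
    by (rule measurable_compose_countable) (rule Suc.IH, use Suc.prems in force)
  then show ?case by simp
qed

lemma measurable_adaptive_weight:
  fixes T :: "'s::countable \<Rightarrow> 'c \<Rightarrow> 's" and \<psi> :: "'s \<Rightarrow> 'c \<Rightarrow> ennreal"
  assumes T: "\<And>y. T y \<in> measurable C (count_space UNIV)"
    and \<psi>: "\<And>y. \<psi> y \<in> borel_measurable C"
    and A: "{..<n} \<subseteq> A"
  shows "(\<lambda>\<xi>. \<Prod>k<n. \<psi> (adaptive_state T x \<xi> k) (\<xi> k)) \<in> borel_measurable (PiM A (\<lambda>_. C))"
proof (rule borel_measurable_prod_ennreal)
  fix k assume "k \<in> {..<n}"
  with A have k: "k \<in> A" "{..<k} \<subseteq> A" by auto
  have "(\<lambda>\<xi>. \<psi> y (\<xi> k)) \<in> borel_measurable (PiM A (\<lambda>_. C))" for y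
    by (rule measurable_compose[OF _ \<psi>]) (use k in \<open>auto intro: measurable_component_singleton\<close>)
  then show "(\<lambda>\<xi>. \<psi> (adaptive_state T x \<xi> k) (\<xi> k)) \<in> borel_measurable (PiM A (\<lambda>_. C))"
    by (rule measurable_compose_countable) (use T k in \<open>auto intro: measurable_adaptive_state\<close>)
qed

text \<open>Induction by conditioning on the past: the state and the earlier factors are functions
  of the inputs before \<open>n\<close>, hence independent of \<open>\<xi> n\<close>, and the last
  factor integrates to at most \<open>r\<close> whatever the state.\<close>

lemma (in prob_space) nn_integral_adaptive_weight_le:
  fixes T :: "'s::countable \<Rightarrow> 'c \<Rightarrow> 's" and \<psi> :: "'s \<Rightarrow> 'c \<Rightarrow> ennreal"
  assumes indep: "indep_vars (\<lambda>_. C) \<xi> (UNIV :: nat set)"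
    and T: "\<And>y. T y \<in> measurable C (count_space UNIV)"
    and \<psi>: "\<And>y. \<psi> y \<in> borel_measurable C"
    and le: "\<And>y k. (\<integral>\<^sup>+\<omega>. \<psi> y (\<xi> k \<omega>) \<partial>M) \<le> r"
  shows "(\<integral>\<^sup>+\<omega>. (\<Prod>k<n. \<psi> (adaptive_state T x (\<lambda>k. \<xi> k \<omega>) k) (\<xi> k \<omega>)) \<partial>M) \<le> r ^ n"
proof (induction n)
  case 0
  show ?case by (simp add: emeasure_space_1)
next
  case (Suc n)
  have rv: "\<xi> k \<in> measurable M C" for k
    using indep by (auto simp: indep_vars_def)
  let ?A = "PiM {..<n} (\<lambda>_. C)" and ?B = "PiM {n} (\<lambda>_. C)"
  \<comment> \<open>\<open>a\<close> is the past and \<open>b\<close> the present, as random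
    elements of product spaces whose joint law factorizes.\<close>
  define a where "a \<omega> = restrict (\<lambda>k. \<xi> k \<omega>) {..<n}" for \<omega>
  define b where "b \<omega> = restrict (\<lambda>k. \<xi> k \<omega>) {n}" for \<omega>
  define w where "w z = (\<Prod>k<n. \<psi> (adaptive_state T x z k) (z k))" for z
  define s where "s z = adaptive_state T x z n" for z
  have ind: "indep_var ?A a ?B b"
    unfolding a_def b_def by (rule indep_var_restrict[OF indep]) auto
  have [measurable]: "a \<in> measurable M ?A" "b \<in> measurable M ?B"
    using ind by (auto dest: indep_var_rv1 indep_var_rv2)
  have [measurable]: "w \<in> borel_measurable ?A"
    unfolding w_def by (rule measurable_adaptive_weight[OF T \<psi>]) auto
  have s[measurable]: "s \<in> measurable ?A (count_space UNIV)"
    unfolding s_def by (rule measurable_adaptive_state[OF T]) auto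
  have [measurable]: "(\<lambda>z. \<psi> y (z n)) \<in> borel_measurable ?B" for y
    by (rule measurable_compose[OF _ \<psi>]) (auto intro: measurable_component_singleton)
  have [measurable]: "(\<lambda>p. \<psi> (s (fst p)) (snd p n)) \<in> borel_measurable (?A \<Otimes>\<^sub>M ?B)"
    by (rule measurable_compose_countable[where f="\<lambda>y p. \<psi> y (snd p n)"]) measurable
  interpret B: prob_space "distr M ?B b" by (rule prob_space_distr) measurable
  have cong: "w (\<lambda>k. \<xi> k \<omega>) = w (a \<omega>)" "s (\<lambda>k. \<xi> k \<omega>) = s (a \<omega>)" for \<omega>
  proof -
    have *: "adaptive_state T x (\<lambda>k. \<xi> k \<omega>) m = adaptive_state T x (a \<omega>) m" if "m \<le> n" for m
      by (rule adaptive_state_cong) (use that in \<open>auto simp: a_def\<close>)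
    then show "w (\<lambda>k. \<xi> k \<omega>) = w (a \<omega>)" "s (\<lambda>k. \<xi> k \<omega>) = s (a \<omega>)"
      by (auto simp: w_def s_def a_def intro!: prod.cong)
  qed
  have "(\<integral>\<^sup>+\<omega>. (\<Prod>k<Suc n. \<psi> (adaptive_state T x (\<lambda>k. \<xi> k \<omega>) k) (\<xi> k \<omega>)) \<partial>M)
      = (\<integral>\<^sup>+\<omega>. w (a \<omega>) * \<psi> (s (a \<omega>)) (b \<omega> n) \<partial>M)"
    by (simp add: w_def[symmetric] s_def[symmetric] cong) (simp add: b_def)
  also have "\<dots> = (\<integral>\<^sup>+p. w (fst p) * \<psi> (s (fst p)) (snd p n) \<partial>distr M (?A \<Otimes>\<^sub>M ?B) (\<lambda>\<omega>. (a \<omega>, b \<omega>)))"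
    by (subst nn_integral_distr) auto
  also have "\<dots> = (\<integral>\<^sup>+p. w (fst p) * \<psi> (s (fst p)) (snd p n) \<partial>(distr M ?A a \<Otimes>\<^sub>M distr M ?B b))"
    using ind by (simp add: indep_var_distribution_eq)
  also have "\<dots> = (\<integral>\<^sup>+y. \<integral>\<^sup>+z. w y * \<psi> (s y) (z n) \<partial>distr M ?B b \<partial>distr M ?A a)"
    by (subst B.nn_integral_fst[symmetric]) auto
  also have "\<dots> = (\<integral>\<^sup>+y. w y * (\<integral>\<^sup>+z. \<psi> (s y) (z n) \<partial>distr M ?B b) \<partial>distr M ?A a)"
    by (intro nn_integral_cong nn_integral_cmult) auto
  also have "\<dots> = (\<integral>\<^sup>+y. w y * (\<integral>\<^sup>+\<omega>. \<psi> (s y) (\<xi> n \<omega>) \<partial>M) \<partial>distr M ?A a)"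
    by (subst nn_integral_distr) (auto simp: b_def)
  also have "\<dots> \<le> (\<integral>\<^sup>+y. w y * r \<partial>distr M ?A a)"
    by (intro nn_integral_mono mult_left_mono le) auto
  also have "\<dots> = (\<integral>\<^sup>+\<omega>. w (a \<omega>) \<partial>M) * r"
    by (subst nn_integral_multc) (auto simp: nn_integral_distr)
  also have "\<dots> \<le> r ^ n * r"
    using Suc[folded w_def] by (intro mult_right_mono) (auto simp: cong)
  finally show ?case by (simp add: mult.commute)
qed

text \<open>Markov's inequality bounds the probability at time \<open>n\<close> by
  \<open>r ^ n / K\<close>; the union bound sums the geometric series.\<close>

lemma (in prob_space) prob_adaptive_weight_gt_le:
  fixes T :: "'s::countable \<Rightarrow> 'c \<Rightarrow> 's" and \<psi> :: "'s \<Rightarrow> 'c \<Rightarrow> ennreal" and K r :: real and x :: 's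
  assumes indep: "indep_vars (\<lambda>_. C) \<xi> (UNIV :: nat set)"
    and T: "\<And>y. T y \<in> measurable C (count_space UNIV)"
    and \<psi>: "\<And>y. \<psi> y \<in> borel_measurable C"
    and le: "\<And>y k. (\<integral>\<^sup>+\<omega>. \<psi> y (\<xi> k \<omega>) \<partial>M) \<le> ennreal r"
    and r: "0 \<le> r" "r < 1" and K: "0 < K"
  defines "B \<equiv> {\<omega> \<in> space M. \<exists>n. (\<Prod>k<n. \<psi> (adaptive_state T x (\<lambda>k. \<xi> k \<omega>) k) (\<xi> k \<omega>)) > ennreal K}"
  shows "B \<in> sets M" and "measure M B \<le> 1 / (K * (1 - r))"
proof -
  have rv[measurable]: "\<xi> k \<in> measurable M C" for k
    using indep by (auto simp: indep_vars_def)
  define w where "w n \<omega> = (\<Prod>k<n. \<psi> (adaptive_state T x (\<lambda>k. \<xi> k \<omega>) k) (\<xi> k \<omega>))" for n \<omega>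
  have [measurable]: "w n \<in> borel_measurable M" for n
  proof -
    have "(\<lambda>\<omega>. \<lambda>k\<in>UNIV. \<xi> k \<omega>) \<in> measurable M (PiM UNIV (\<lambda>_. C))"
      by (rule measurable_restrict) (auto intro: rv)
    from measurable_compose[OF this measurable_adaptive_weight[OF T \<psi>, where n=n]]
    show ?thesis unfolding w_def by (auto simp: restrict_def)
  qed
  define E where "E n = {\<omega> \<in> space M. w n \<omega> > ennreal K}" for n
  have [measurable]: "E n \<in> sets M" for n unfolding E_def by measurable
  have B: "B = (\<Union>n. E n)" unfolding B_def E_def w_def by auto
  then show "B \<in> sets M" by simp
  have E: "measure M (E n) \<le> r ^ n / K" for n
  proof -
    have "ennreal K * emeasure M (E n) = (\<integral>\<^sup>+\<omega>. ennreal K * indicator (E n) \<omega> \<partial>M)"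
      by (simp add: nn_integral_cmult_indicator)
    also have "\<dots> \<le> (\<integral>\<^sup>+\<omega>. w n \<omega> \<partial>M)"
      by (intro nn_integral_mono) (auto simp: E_def split: split_indicator)
    also have "\<dots> \<le> ennreal r ^ n"
      unfolding w_def by (rule nn_integral_adaptive_weight_le[OF indep T \<psi> le])
    finally have "ennreal (K * measure M (E n)) \<le> ennreal (r ^ n)"
      using r K by (simp add: emeasure_eq_measure ennreal_mult ennreal_power)
    then show ?thesis using r K by (simp add: field_simps)
  qed
  have sm: "(\<lambda>n. r ^ n / K) sums (1 / (1 - r) / K)"
    by (intro sums_divide geometric_sums) (use r in auto)
  have "measure M (\<Union>n. E n) \<le> (\<Sum>n. measure M (E n))"
    by (rule finite_measure_subadditive_countably)
      (auto intro: summable_comparison_test'[OF sums_summable[OF sm], of 0] simp: E)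
  also have "\<dots> \<le> (\<Sum>n. r ^ n / K)"
    by (intro suminf_le E sums_summable[OF sm] summable_comparison_test'[OF sums_summable[OF sm], of 0]) (auto simp: E)
  also have "\<dots> = 1 / (K * (1 - r))"
    using sums_unique[OF sm] by (simp add: field_simps)
  finally show "measure M B \<le> 1 / (K * (1 - r))" using B by simp
qed

section \<open>Exponential moments of the truncated supremum\<close>

text \<open>Supplies the dominating function for difference quotients of exponentials at 0. Either
  sign of \<open>x\<close> reduces to 1 + y \<le> exp y.\<close>

lemma abs_one_minus_exp_le: "\<bar>1 - exp (- x)\<bar> \<le> \<bar>x\<bar> * exp \<bar>x\<bar>" for x :: real
proof (cases "x \<ge> 0")
  case True
  have "1 - exp (- x) \<le> x" using exp_ge_add_one_self[of "-x"] by linarith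
  also have "x \<le> x * exp x" using True by (simp add: mult_le_cancel_left1)
  finally show ?thesis using True by simp
next
  case False
  have "exp (- x) - 1 = exp (- x) * (1 - exp x)" by (simp add: algebra_simps exp_minus)
  also have "\<dots> \<le> exp (- x) * (- x)"
    using exp_ge_add_one_self[of x] by (intro mult_left_mono) (linarith, simp)
  finally show ?thesis using False by (simp add: mult.commute)
qed

text \<open>As a function of \<open>t\<close>, the expectation of \<open>exp (- t * w)\<close> has
  value 1 and negative derivative at 0, so it falls below 1 for some small positive
  \<open>t\<close>. Dominated convergence is applied to difference quotients along a
  sequence.\<close>

lemma (in prob_space) ex_exp_moment_less_one:
  fixes w :: "'a \<Rightarrow> real"
  assumes w[measurable]: "w \<in> borel_measurable M"
    and int: "integrable M (\<lambda>\<omega>. exp (\<theta> * \<bar>w \<omega>\<bar>))" and \<theta>: "\<theta> > 0"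
    and pos: "expectation w > 0"
  obtains t where "t > 0" "integrable M (\<lambda>\<omega>. exp (- t * w \<omega>))" "expectation (\<lambda>\<omega>. exp (- t * w \<omega>)) < 1"
proof -
  \<comment> \<open>Staying below \<theta>/2 leaves the other half of the exponent to absorb the
    linear factor in \<open>bound\<close>.\<close>
  define t where "t n = \<theta> / 2 / real (Suc n)" for n
  have t: "t n > 0" "t n \<le> \<theta> / 2" for n
    using \<theta> by (auto simp: t_def divide_simps)
  have "t \<longlonglongrightarrow> 0" unfolding t_def by (rule lim_const_over_n[THEN LIMSEQ_Suc])
  then have t_lim: "filterlim t (at 0) sequentially"
    using t(1) by (auto simp: filterlim_at less_imp_neq[symmetric])
  define s where "s n \<omega> = (1 - exp (- t n * w \<omega>)) / t n" for n \<omega>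
  have bound: "\<bar>s n \<omega>\<bar> \<le> 2 / \<theta> * exp (\<theta> * \<bar>w \<omega>\<bar>)" for n \<omega>
  proof -
    have "\<bar>s n \<omega>\<bar> = \<bar>1 - exp (- (t n * w \<omega>))\<bar> / t n" using t[of n] by (simp add: s_def)
    also have "\<dots> \<le> \<bar>t n * w \<omega>\<bar> * exp \<bar>t n * w \<omega>\<bar> / t n"
      by (intro divide_right_mono abs_one_minus_exp_le) (use t[of n] in auto)
    also have "\<dots> = \<bar>w \<omega>\<bar> * exp (t n * \<bar>w \<omega>\<bar>)" using t[of n] by (simp add: abs_mult)
    also have "\<dots> \<le> (2 / \<theta> * exp (\<theta> / 2 * \<bar>w \<omega>\<bar>)) * exp (\<theta> / 2 * \<bar>w \<omega>\<bar>)"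
    proof (intro mult_mono)
      have "\<theta> / 2 * \<bar>w \<omega>\<bar> \<le> exp (\<theta> / 2 * \<bar>w \<omega>\<bar>)"
        using exp_ge_add_one_self[of "\<theta> / 2 * \<bar>w \<omega>\<bar>"] by linarith
      then show "\<bar>w \<omega>\<bar> \<le> 2 / \<theta> * exp (\<theta> / 2 * \<bar>w \<omega>\<bar>)" using \<theta> by (simp add: field_simps)
      show "exp (t n * \<bar>w \<omega>\<bar>) \<le> exp (\<theta> / 2 * \<bar>w \<omega>\<bar>)"
        using t(2)[of n] unfolding exp_le_cancel_iff by (rule mult_right_mono) simp
    qed (use \<theta> in auto)
    also have "\<dots> = 2 / \<theta> * exp (\<theta> * \<bar>w \<omega>\<bar>)" by (simp flip: exp_add)
    finally show ?thesis .
  qed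
  have lim: "(\<lambda>n. s n \<omega>) \<longlonglongrightarrow> w \<omega>" for \<omega>
  proof -
    have "((\<lambda>t. - exp (- t * w \<omega>)) has_real_derivative w \<omega>) (at 0)"
      by (auto intro!: derivative_eq_intros)
    from DERIV_D[OF this] have "((\<lambda>h. (1 - exp (- h * w \<omega>)) / h) \<longlongrightarrow> w \<omega>) (at 0)" by simp
    from filterlim_compose[OF this t_lim] show ?thesis by (simp add: s_def)
  qed
  have ints: "integrable M (\<lambda>\<omega>. 2 / \<theta> * exp (\<theta> * \<bar>w \<omega>\<bar>))" using int by simp
  have [measurable]: "s n \<in> borel_measurable M" for n unfolding s_def by measurable
  have "(\<lambda>n. expectation (s n)) \<longlonglongrightarrow> expectation w"
    by (rule integral_dominated_convergence[OF _ _ ints]) (use bound in \<open>simp_all add: lim\<close>)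
  then have "eventually (\<lambda>n. expectation (s n) > 0) sequentially"
    using pos by (rule order_tendstoD)
  then obtain n where n: "expectation (s n) > 0" by (auto simp: eventually_sequentially)
  have int_s: "integrable M (s n)"
    by (rule Bochner_Integration.integrable_bound[OF ints]) (use bound \<theta> in \<open>auto simp: abs_mult\<close>)
  \<comment> \<open>In this form a positive expectation of \<open>s n\<close> is the same as an
    exponential moment below 1.\<close>
  have eq: "exp (- t n * w \<omega>) = 1 - t n * s n \<omega>" for \<omega> using t[of n] by (simp add: s_def)
  show thesis
  proof
    show "t n > 0" by (rule t)
    show "integrable M (\<lambda>\<omega>. exp (- t n * w \<omega>))" unfolding eq using int_s by simp
    show "expectation (\<lambda>\<omega>. exp (- t n * w \<omega>)) < 1"
      unfolding eq using int_s n t(1)[of n] by (simp add: prob_space)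
  qed
qed

section \<open>Truncated scores and their exponential weights\<close>

definition score :: "int \<Rightarrow> (nat \<Rightarrow> ereal) \<Rightarrow> nat \<Rightarrow> ereal" where
  "score L z m = min (z m) (ereal (real_of_int L)) - ereal (real m)"

definition best_score :: "int \<Rightarrow> (nat \<Rightarrow> ereal) \<Rightarrow> ereal" where
  "best_score L z = (SUP m. score L z m)"

text \<open>The case -\<infinity> is separate because \<open>real_of_ereal\<close> sends it to 0;
  the value \<infinity> makes any finite bound on the weight exclude it. The argument +\<infinity>
  does not arise for best scores, which are at most \<open>L\<close>.\<close>

definition exp_weight :: "real \<Rightarrow> real \<Rightarrow> ereal \<Rightarrow> ennreal" where
  "exp_weight \<theta> a x = (if x = -\<infinity> then \<infinity> else ennreal (exp (\<theta> * (a - real_of_ereal x))))"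

lemma measurable_exp_weight[measurable]: "exp_weight \<theta> a \<in> borel_measurable borel"
  unfolding exp_weight_def[abs_def] by measurable

lemma score_le: "score L z m \<le> ereal (real_of_int L - real m)"
proof -
  have "score L z m \<le> ereal (real_of_int L) - ereal (real m)"
    unfolding score_def by (intro ereal_minus_mono) auto
  then show ?thesis by simp
qed

lemma best_score_le: "best_score L z \<le> ereal (real_of_int L)"
  unfolding best_score_def
proof (rule SUP_least)
  fix m show "score L z m \<le> ereal (real_of_int L)"
    by (rule order_trans[OF score_le]) simp
qed

lemma score_le_best_score: "score L z m \<le> best_score L z"
  unfolding best_score_def by (rule SUP_upper) simp

lemma score_mono: "L \<le> L' \<Longrightarrow> score L z m \<le> score L' z m"
  unfolding score_def by (intro ereal_minus_mono min.mono) auto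

lemma best_score_mono: "L \<le> L' \<Longrightarrow> best_score L z \<le> best_score L' z"
  unfolding best_score_def by (intro SUP_mono') (rule score_mono)

lemma best_score_ge: "ereal (real_of_int c) \<le> z t \<Longrightarrow> c \<le> L \<Longrightarrow> ereal (real_of_int c - real t) \<le> best_score L z"
proof -
  assume "ereal (real_of_int c) \<le> z t" "c \<le> L"
  then have "ereal (real_of_int c) - ereal (real t) \<le> score L z t"
    unfolding score_def by (intro ereal_minus_mono) auto
  then show ?thesis using score_le_best_score[of L z t] by simp
qed

text \<open>Scores increase with the truncation level, so the limit is a supremum, which commutes
  with the supremum over \<open>m\<close>. The offset \<open>k\<close> lets the truncation start at
  any level.\<close>

lemma tendsto_best_score:
  "(\<lambda>n. best_score (int n + k) z) \<longlonglongrightarrow> (SUP m. z m - ereal (real m))"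
proof -
  have "(SUP n. score (int n + k) z m) = z m - ereal (real m)" for m
  proof -
    have "incseq (\<lambda>n. score (int n + k) z m)" by (auto simp: incseq_def intro!: score_mono)
    then have "(\<lambda>n. score (int n + k) z m) \<longlonglongrightarrow> (SUP n. score (int n + k) z m)" by (rule LIMSEQ_SUP)
    moreover have "(\<lambda>n. score (int n + k) z m) \<longlonglongrightarrow> min (z m) \<infinity> - ereal (real m)"
      unfolding score_def
    proof (intro tendsto_diff_ereal_general tendsto_min tendsto_const)
      have "filterlim (\<lambda>n. real n + real_of_int k) at_top sequentially"
        by (subst add.commute, rule filterlim_tendsto_add_at_top[OF tendsto_const])
          (rule filterlim_real_sequentially)
      then show "(\<lambda>n. ereal (real_of_int (int n + k))) \<longlonglongrightarrow> \<infinity>"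
        by (simp add: tendsto_PInfty_eq_at_top)
    qed auto
    ultimately show ?thesis by (auto dest: LIMSEQ_unique)
  qed
  then have "(SUP n. best_score (int n + k) z) = (SUP m. z m - ereal (real m))"
    unfolding best_score_def by (subst SUP_commute) simp
  moreover have "incseq (\<lambda>n. best_score (int n + k) z)" by (auto simp: incseq_def intro!: best_score_mono)
  then have "(\<lambda>n. best_score (int n + k) z) \<longlonglongrightarrow> (SUP n. best_score (int n + k) z)" by (rule LIMSEQ_SUP)
  ultimately show ?thesis by simp
qed

text \<open>At the first index \<open>t\<close> with \<open>c \<le> z t\<close> the score is at
  least \<open>c - t\<close>, so the weight is at most the \<open>t\<close>-th term of the series.
  Without such an index every term is at least 1 and the series diverges.\<close>

lemma exp_weight_best_score_le:
  assumes "c \<le> L" and \<theta>: "\<theta> > 0"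
  shows "exp_weight \<theta> (real_of_int c) (best_score L z)
    \<le> (\<Sum>t. ennreal (exp (\<theta> * real t)) * indicator {z. \<forall>m<t. z m < ereal (real_of_int c)} z)"
    (is "_ \<le> suminf ?g")
proof (cases "\<exists>t. ereal (real_of_int c) \<le> z t")
  case True
  define t where "t = (LEAST t. ereal (real_of_int c) \<le> z t)"
  have t: "ereal (real_of_int c) \<le> z t" unfolding t_def using True by (rule LeastI_ex)
  have min: "z m < ereal (real_of_int c)" if "m < t" for m
    using not_less_Least[of m "\<lambda>t. ereal (real_of_int c) \<le> z t"] that by (auto simp: t_def)
  have ge: "ereal (real_of_int c - real t) \<le> best_score L z" using t assms(1) by (rule best_score_ge)
  then obtain x where x: "best_score L z = ereal x"
    using best_score_le[of L z] by (cases "best_score L z") auto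
  have "exp_weight \<theta> (real_of_int c) (best_score L z) \<le> ennreal (exp (\<theta> * real t))"
    using ge \<theta> by (auto simp: x exp_weight_def intro!: ennreal_leI)
  also have "\<dots> = sum ?g {t}" using min by simp
  also have "\<dots> \<le> suminf ?g" by (rule sum_le_suminf) auto
  finally show ?thesis .
next
  case False
  have "ennreal (real n) \<le> suminf ?g" for n
  proof -
    have "ennreal (real n) = (\<Sum>t<n. ennreal 1)" by (simp add: ennreal_of_nat_eq_real_of_nat)
    also have "\<dots> \<le> sum ?g {..<n}"
      using False \<theta> by (intro sum_mono) (auto simp: not_le simp del: ennreal_1 intro!: ennreal_leI)
    also have "\<dots> \<le> suminf ?g" by (rule sum_le_suminf) auto
    finally show ?thesis .
  qed
  then have "(SUP n. of_nat n :: ennreal) \<le> suminf ?g"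
    by (intro SUP_least) (auto simp: ennreal_of_nat_eq_real_of_nat)
  then have "suminf ?g = top" by (simp add: ennreal_SUP_of_nat_eq_top top_unique)
  then show ?thesis by simp
qed

section \<open>Geometric tails from independence, and the positive exponential drift\<close>

lemma measurable_int_minf_subset_borel: "measurable M (count_space int_minf) \<subseteq> borel_measurable M"
proof
  fix X :: "'a \<Rightarrow> ereal" assume "X \<in> measurable M (count_space int_minf)"
  moreover have "(\<lambda>x. x) \<in> borel_measurable (count_space int_minf)" by simp
  ultimately show "X \<in> borel_measurable M" by (rule measurable_compose)
qed

lemma (in prob_space) prob_all_less_le_power:
  fixes Z :: "nat \<Rightarrow> 'a \<Rightarrow> ereal"
  assumes indep: "indep_vars (\<lambda>_. count_space int_minf) Z UNIV"
    and p: "\<And>m. prob {\<omega> \<in> space M. Z m \<omega> < x} \<le> p"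
  shows "prob {\<omega> \<in> space M. \<forall>m<t. Z m \<omega> < x} \<le> p ^ t"
\<comment> \<open>The product formula needs a nonempty index set: the empty intersection is not
  \<open>space M\<close>.\<close>
proof (cases "t = 0")
  case True
  then show ?thesis by (simp add: prob_space)
next
  case False
  have rv: "random_variable (count_space int_minf) (Z m)" for m
    using indep by (auto simp: indep_vars_def)
  \<comment> \<open>Cut down to \<open>int_minf\<close>, the space of the target, to be measurable
    there.\<close>
  let ?A = "{y \<in> int_minf. y < x}"
  have eq: "Z m -` ?A \<inter> space M = {\<omega> \<in> space M. Z m \<omega> < x}" for m
    using measurable_space[OF rv[of m]] by auto
  have "{\<omega> \<in> space M. \<forall>m<t. Z m \<omega> < x} = (\<Inter>m\<in>{..<t}. Z m -` ?A \<inter> space M)"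
    using False unfolding eq by auto
  also have "prob \<dots> = (\<Prod>m\<in>{..<t}. prob (Z m -` ?A \<inter> space M))"
    by (rule indep_varsD[OF indep]) (use False in auto)
  also have "\<dots> \<le> (\<Prod>m\<in>{..<t}. p)" unfolding eq by (intro prod_mono) (auto simp: p)
  finally show ?thesis by simp
qed

text \<open>The event that the first \<open>t\<close> values all miss \<open>c\<close> has weight
  \<open>exp (\<theta> * t)\<close> and probability at most \<open>p ^ t\<close>, which leaves a
  geometric series of ratio \<open>exp \<theta> * p\<close>.\<close>

lemma (in prob_space) nn_integral_exp_weight_best_score_finite:
  fixes Z :: "nat \<Rightarrow> 'a \<Rightarrow> ereal"
  assumes indep: "indep_vars (\<lambda>_. count_space int_minf) Z UNIV"
    and p: "\<And>m. prob {\<omega> \<in> space M. Z m \<omega> < ereal (real_of_int c)} \<le> p"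
    and \<theta>: "\<theta> > 0" "exp \<theta> * p < 1" and L: "c \<le> L"
  shows "(\<integral>\<^sup>+\<omega>. exp_weight \<theta> (real_of_int c) (best_score L (\<lambda>m. Z m \<omega>)) \<partial>M) < \<infinity>"
proof -
  have rv: "random_variable (count_space int_minf) (Z m)" for m
    using indep by (auto simp: indep_vars_def)
  have [measurable]: "Z m \<in> borel_measurable M" for m
    using rv measurable_int_minf_subset_borel by blast
  have p0: "p \<ge> 0" using p[of 0] measure_nonneg order_trans by blast
  define E where "E t = {\<omega> \<in> space M. \<forall>m<t. Z m \<omega> < ereal (real_of_int c)}" for t :: nat
  have [measurable]: "E t \<in> sets M" for t unfolding E_def by measurable
  have E: "prob (E t) \<le> p ^ t" for t
    unfolding E_def using indep p by (rule prob_all_less_le_power)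
  have "(\<integral>\<^sup>+\<omega>. exp_weight \<theta> (real_of_int c) (best_score L (\<lambda>m. Z m \<omega>)) \<partial>M)
     \<le> (\<integral>\<^sup>+\<omega>. (\<Sum>t. ennreal (exp (\<theta> * real t)) * indicator (E t) \<omega>) \<partial>M)"
  proof (rule nn_integral_mono)
    fix \<omega> assume "\<omega> \<in> space M"
    then show "exp_weight \<theta> (real_of_int c) (best_score L (\<lambda>m. Z m \<omega>))
      \<le> (\<Sum>t. ennreal (exp (\<theta> * real t)) * indicator (E t) \<omega>)"
      using exp_weight_best_score_le[OF L \<theta>(1), of "\<lambda>m. Z m \<omega>"]
      by (simp add: E_def indicator_def)
  qed
  also have "\<dots> = (\<Sum>t. ennreal (exp (\<theta> * real t)) * emeasure M (E t))"
    by (subst nn_integral_suminf) (auto simp: nn_integral_cmult_indicator)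
  also have "\<dots> \<le> (\<Sum>t. ennreal ((exp \<theta> * p) ^ t))"
  proof (intro suminf_le)
    fix t
    have "exp (\<theta> * real t) * prob (E t) \<le> exp (\<theta> * real t) * p ^ t"
      using E by (intro mult_left_mono) auto
    also have "\<dots> = (exp \<theta> * p) ^ t"
      by (simp add: power_mult_distrib exp_of_nat_mult[symmetric] mult.commute)
    finally show "ennreal (exp (\<theta> * real t)) * emeasure M (E t) \<le> ennreal ((exp \<theta> * p) ^ t)"
      by (simp add: emeasure_eq_measure ennreal_mult[symmetric] ennreal_leI)
  qed auto
  also have "\<dots> = ennreal (\<Sum>t. (exp \<theta> * p) ^ t)"
    using \<theta> p0 by (intro suminf_ennreal2) (auto intro!: summable_geometric)
  also have "\<dots> < \<infinity>" by simp
  finally show ?thesis .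
qed

lemma borel_measurable_best_score[measurable (raw)]:
  assumes [measurable]: "\<And>m. Z m \<in> borel_measurable M"
  shows "(\<lambda>\<omega>. best_score L (\<lambda>m. Z m \<omega>)) \<in> borel_measurable M"
  unfolding best_score_def score_def by measurable

text \<open>Three choices in turn: a level \<open>c\<close> reached with positive probability,
  giving a geometric lower tail; a truncation level \<open>L\<close> that keeps the expected best
  score above \<open>F\<close>; an exponent so small that the exponential moment of the centred
  score is below 1.\<close>

lemma (in prob_space) ex_exponential_drift:
  fixes Z :: "nat \<Rightarrow> 'a \<Rightarrow> ereal" and F :: int
  assumes indep: "indep_vars (\<lambda>_. count_space int_minf) Z UNIV"
    and id: "\<And>m. distr M (count_space int_minf) (Z m) = D"
    and gt: "ext_expectation M (\<lambda>\<omega>. SUP m. Z m \<omega> - ereal (real m)) > ereal (real_of_int F)"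
  obtains L c :: int and \<beta> \<theta> r :: real
  where "\<beta> > 0" "\<theta> > 0" "0 \<le> r" "r < 1"
    "measure D {x \<in> int_minf. x < ereal (real_of_int c)} < 1"
    "(\<integral>\<^sup>+\<omega>. exp_weight \<theta> (real_of_int F + \<beta>) (best_score L (\<lambda>m. Z m \<omega>)) \<partial>M) = ennreal r"
proof -
  have rv: "random_variable (count_space int_minf) (Z m)" for m
    using indep by (auto simp: indep_vars_def)
  have Zm[measurable]: "Z m \<in> borel_measurable M" for m
    using rv measurable_int_minf_subset_borel by blast
  define p where "p c = measure D {x \<in> int_minf. x < ereal (real_of_int c)}" for c
  have p: "prob {\<omega> \<in> space M. Z m \<omega> < ereal (real_of_int c)} = p c" for m c
  proof -
    have "p c = prob (Z m -` {x \<in> int_minf. x < ereal (real_of_int c)} \<inter> space M)"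
      unfolding p_def id[of m, symmetric] by (subst measure_distr[OF rv]) auto
    also have "Z m -` {x \<in> int_minf. x < ereal (real_of_int c)} \<inter> space M
        = {\<omega> \<in> space M. Z m \<omega> < ereal (real_of_int c)}"
      using measurable_space[OF rv[of m]] by auto
    finally show ?thesis by simp
  qed
  define Y where "Y \<omega> = (SUP m. Z m \<omega> - ereal (real m))" for \<omega>
  have Y[measurable]: "Y \<in> borel_measurable M" unfolding Y_def by measurable
  \<comment> \<open>If almost surely no integer level were reached, all \<open>Z m\<close> and hence
    \<open>Y\<close> would be -\<infinity>, and so would the expectation.\<close>
  have "\<exists>c. p c < 1"
  proof (rule ccontr)
    assume "\<nexists>c. p c < 1"
    then have "prob {\<omega> \<in> space M. Z m \<omega> < ereal (real_of_int c)} = 1" for m c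
      unfolding p using prob_le_1 p by (metis antisym not_le)
    then have "AE \<omega> in M. \<forall>m c. Z m \<omega> < ereal (real_of_int c)"
      by (subst AE_all_countable, intro allI, subst AE_all_countable, intro allI)
        (subst (asm) prob_Collect_eq_1, auto)
    then have "AE \<omega> in M. Y \<omega> = -\<infinity>"
    proof eventually_elim
      case (elim \<omega>)
      have "Z m \<omega> = -\<infinity>" for m
      proof (rule ereal_bot)
        fix B show "Z m \<omega> \<le> ereal B"
          using elim[rule_format, of m "\<lfloor>B\<rfloor>"] by (rule less_imp_le[OF less_le_trans]) simp
      qed
      then show ?case by (simp add: Y_def)
    qed
    then have "(\<integral>\<^sup>+\<omega>. e2ennreal (Y \<omega>) \<partial>M) = (\<integral>\<^sup>+\<omega>. 0 \<partial>M)" "(\<integral>\<^sup>+\<omega>. e2ennreal (- Y \<omega>) \<partial>M) = (\<integral>\<^sup>+\<omega>. \<infinity> \<partial>M)"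
      by (intro nn_integral_cong_AE; eventually_elim; simp add: e2ennreal_neg)+
    then have "ext_expectation M Y = -\<infinity>"
      by (simp add: ext_expectation_def emeasure_space_1 zero_ennreal.rep_eq)
    then show False using gt[folded Y_def] by simp
  qed
  then obtain c where c: "p c < 1" ..
  have p0: "p c \<ge> 0" by (simp add: p_def)
  obtain \<theta>0 where \<theta>0: "\<theta>0 > 0" "exp \<theta>0 * p c < 1"
  proof (cases "p c = 0")
    case True
    then show thesis by (intro that[of 1]) auto
  next
    case False
    then have pos: "p c > 0" using p0 by simp
    show thesis
    proof
      \<comment> \<open>With this exponent the product \<open>exp \<theta>0 * p c\<close> is the
        square root of \<open>p c\<close>.\<close>
      show "- ln (p c) / 2 > 0" using c pos by simp
      have "exp (- ln (p c) / 2) < exp (- ln (p c))" using c pos by simp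
      also have "\<dots> = 1 / p c" using pos by (simp add: exp_minus field_simps)
      finally show "exp (- ln (p c) / 2) * p c < 1" using pos by (simp add: field_simps)
    qed
  qed
  let ?best = "\<lambda>L \<omega>. best_score L (\<lambda>m. Z m \<omega>)"
  have fin: "(\<integral>\<^sup>+\<omega>. exp_weight \<theta>0 (real_of_int c) (?best L \<omega>) \<partial>M) < \<infinity>" if "c \<le> L" for L
    using indep _ \<theta>0 that by (rule nn_integral_exp_weight_best_score_finite) (simp add: p)
  \<comment> \<open>By y \<le> exp y, the negative part is at most a constant plus a multiple of the
    exponential weight.\<close>
  have neg_fin: "(\<integral>\<^sup>+\<omega>. e2ennreal (- ?best L \<omega>) \<partial>M) < \<infinity>" if L: "c \<le> L" for L
  proof -
    have "e2ennreal (- ?best L \<omega>) \<le> ennreal \<bar>real_of_int c\<bar> + ennreal (1 / \<theta>0) * exp_weight \<theta>0 (real_of_int c) (?best L \<omega>)" for \<omega>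
    proof (cases "?best L \<omega>")
      case (real x)
      have "\<theta>0 * (c - x) \<le> exp (\<theta>0 * (c - x))" using exp_ge_add_one_self[of "\<theta>0 * (c - x)"] by linarith
      then have "c - x \<le> 1 / \<theta>0 * exp (\<theta>0 * (c - x))" using \<theta>0 by (simp add: field_simps)
      then have "- x \<le> \<bar>real_of_int c\<bar> + 1 / \<theta>0 * exp (\<theta>0 * (c - x))" by linarith
      then have "ennreal (- x) \<le> ennreal (\<bar>real_of_int c\<bar> + 1 / \<theta>0 * exp (\<theta>0 * (c - x)))" by (rule ennreal_leI)
      also have "\<dots> = ennreal \<bar>real_of_int c\<bar> + ennreal (1 / \<theta>0 * exp (\<theta>0 * (c - x)))"
        using \<theta>0 by (intro ennreal_plus) auto
      also have "ennreal (1 / \<theta>0 * exp (\<theta>0 * (c - x))) = ennreal (1 / \<theta>0) * ennreal (exp (\<theta>0 * (c - x)))"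
        using \<theta>0 by (intro ennreal_mult) auto
      finally show ?thesis by (simp add: real exp_weight_def)
    next
      case PInf
      then show ?thesis using best_score_le[of L "\<lambda>m. Z m \<omega>"] by simp
    next
      case MInf
      then show ?thesis using \<theta>0 by (simp add: exp_weight_def ennreal_mult_top)
    qed
    then have "(\<integral>\<^sup>+\<omega>. e2ennreal (- ?best L \<omega>) \<partial>M)
      \<le> (\<integral>\<^sup>+\<omega>. ennreal \<bar>real_of_int c\<bar> + ennreal (1 / \<theta>0) * exp_weight \<theta>0 (real_of_int c) (?best L \<omega>) \<partial>M)"
      by (intro nn_integral_mono)
    also have "\<dots> = ennreal \<bar>real_of_int c\<bar> + ennreal (1 / \<theta>0) * (\<integral>\<^sup>+\<omega>. exp_weight \<theta>0 (real_of_int c) (?best L \<omega>) \<partial>M)"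
      by (subst nn_integral_add) (auto simp: nn_integral_cmult emeasure_space_1)
    also have "\<dots> < \<infinity>" using fin[OF L] by (simp add: ennreal_mult_less_top)
    finally show ?thesis .
  qed
  \<comment> \<open>Positive parts converge monotonically, negative parts under domination by the
    one for level \<open>c\<close>. The offset \<open>c\<close> keeps every truncation level in the
    range where \<open>neg_fin\<close> applies.\<close>
  have "(\<lambda>n. ext_expectation M (?best (int n + c))) \<longlonglongrightarrow> ext_expectation M Y"
    unfolding ext_expectation_def
  proof (intro tendsto_diff_ereal_general tendsto_enn2erealI)
    have lim: "(\<lambda>n. ?best (int n + c) \<omega>) \<longlonglongrightarrow> Y \<omega>" for \<omega>
      unfolding Y_def by (rule tendsto_best_score)
    show "(\<lambda>n. \<integral>\<^sup>+\<omega>. e2ennreal (?best (int n + c) \<omega>) \<partial>M) \<longlonglongrightarrow> (\<integral>\<^sup>+\<omega>. e2ennreal (Y \<omega>) \<partial>M)"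
      by (rule nn_integral_LIMSEQ)
        (auto simp: incseq_def le_fun_def intro!: e2ennreal_mono best_score_mono tendsto_e2ennrealI lim)
    have neg_mono: "e2ennreal (- ?best (int n + c) \<omega>) \<le> e2ennreal (- ?best c \<omega>)" for n \<omega>
      by (intro e2ennreal_mono) (simp add: best_score_mono)
    show "(\<lambda>n. \<integral>\<^sup>+\<omega>. e2ennreal (- ?best (int n + c) \<omega>) \<partial>M) \<longlonglongrightarrow> (\<integral>\<^sup>+\<omega>. e2ennreal (- Y \<omega>) \<partial>M)"
      by (rule nn_integral_dominated_convergence[OF _ _ _ _ neg_fin[OF order_refl]])
        (auto simp: neg_mono intro!: tendsto_e2ennrealI tendsto_uminus_ereal lim)
    have "(\<integral>\<^sup>+\<omega>. e2ennreal (- Y \<omega>) \<partial>M) \<le> (\<integral>\<^sup>+\<omega>. e2ennreal (- ?best c \<omega>) \<partial>M)"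
    proof (intro nn_integral_mono e2ennreal_mono)
      fix \<omega>
      have "?best c \<omega> \<le> Y \<omega>"
        by (rule Lim_bounded2[OF lim, of 0]) (auto intro: best_score_mono)
      then show "- Y \<omega> \<le> - ?best c \<omega>" by simp
    qed
    then have "(\<integral>\<^sup>+\<omega>. e2ennreal (- Y \<omega>) \<partial>M) < \<infinity>" using neg_fin[of c] by (simp add: le_less_trans)
    \<comment> \<open>Subtraction is continuous except at \<infinity> - \<infinity>, which the
      finite negative part rules out.\<close>
    then show "\<not> (enn2ereal (\<integral>\<^sup>+\<omega>. e2ennreal (Y \<omega>) \<partial>M) = \<infinity> \<and> enn2ereal (\<integral>\<^sup>+\<omega>. e2ennreal (- Y \<omega>) \<partial>M) = \<infinity> \<or>
       enn2ereal (\<integral>\<^sup>+\<omega>. e2ennreal (Y \<omega>) \<partial>M) = -\<infinity> \<and> enn2ereal (\<integral>\<^sup>+\<omega>. e2ennreal (- Y \<omega>) \<partial>M) = -\<infinity>)"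
      using enn2ereal_nonneg[of "\<integral>\<^sup>+\<omega>. e2ennreal (Y \<omega>) \<partial>M"]
      by (auto simp: enn2ereal_eq_top_iff[unfolded infinity_ereal_def[symmetric]])
  qed
  then have "eventually (\<lambda>n. ext_expectation M (?best (int n + c)) > ereal (real_of_int F)) sequentially"
    using gt[folded Y_def] by (rule order_tendstoD)
  then obtain n where "ext_expectation M (?best (int n + c)) > ereal (real_of_int F)"
    by (auto simp: eventually_sequentially)
  then obtain L where L: "c \<le> L" "ext_expectation M (?best L) > ereal (real_of_int F)"
    by (metis le_add_same_cancel2 of_nat_0_le_iff)
  define y where "y \<omega> = real_of_ereal (?best L \<omega>)" for \<omega>
  have [measurable]: "y \<in> borel_measurable M" unfolding y_def by measurable
  have "AE \<omega> in M. exp_weight \<theta>0 (real_of_int c) (?best L \<omega>) \<noteq> \<infinity>"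
    using fin[OF L(1)] by (intro nn_integral_PInf_AE) auto
  then have AE_y: "AE \<omega> in M. ?best L \<omega> = ereal (y \<omega>) \<and> y \<omega> \<le> L"
  proof eventually_elim
    case (elim \<omega>)
    then show ?case using best_score_le[of L "\<lambda>m. Z m \<omega>"]
      by (cases "?best L \<omega>") (auto simp: exp_weight_def y_def)
  qed
  have exp_int: "integrable M (\<lambda>\<omega>. exp (\<theta>0 * \<bar>y \<omega> - a\<bar>))" for a
  proof (rule integrableI_bounded)
    \<comment> \<open>Since \<open>y\<close> is at most \<open>L\<close>, the distance of
      \<open>y\<close> from \<open>c\<close> is at most \<open>2 * (L - c) + (c - y)\<close>; this
      reduces the two-sided moment to the lower tail.\<close>
    define C where "C = exp (\<theta>0 * (\<bar>c - a\<bar> + 2 * (L - c)))"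
    have "(\<integral>\<^sup>+\<omega>. ennreal (norm (exp (\<theta>0 * \<bar>y \<omega> - a\<bar>))) \<partial>M)
      \<le> (\<integral>\<^sup>+\<omega>. ennreal C * exp_weight \<theta>0 (real_of_int c) (?best L \<omega>) \<partial>M)"
    proof (rule nn_integral_mono_AE, use AE_y in eventually_elim)
      case (elim \<omega>)
      have "\<bar>y \<omega> - a\<bar> \<le> \<bar>c - a\<bar> + \<bar>y \<omega> - c\<bar>" by linarith
      moreover have "\<bar>y \<omega> - c\<bar> \<le> 2 * (L - c) + (c - y \<omega>)"
        using elim[THEN conjunct2] L(1) by (auto simp: abs_le_iff)
      ultimately have "\<bar>y \<omega> - a\<bar> \<le> \<bar>c - a\<bar> + 2 * (L - c) + (c - y \<omega>)" by linarith
      then have "exp (\<theta>0 * \<bar>y \<omega> - a\<bar>) \<le> exp (\<theta>0 * (\<bar>c - a\<bar> + 2 * (L - c) + (c - y \<omega>)))"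
        using \<theta>0 by simp
      also have "\<dots> = C * exp (\<theta>0 * (c - y \<omega>))" by (simp add: C_def algebra_simps flip: exp_add)
      finally show ?case using elim by (simp add: exp_weight_def C_def ennreal_mult'[symmetric] ennreal_leI)
    qed
    also have "\<dots> < \<infinity>" using fin[OF L(1)] by (simp add: nn_integral_cmult ennreal_mult_less_top)
    finally show "(\<integral>\<^sup>+\<omega>. ennreal (norm (exp (\<theta>0 * \<bar>y \<omega> - a\<bar>))) \<partial>M) < \<infinity>" .
  qed measurable
  have y_int: "integrable M y"
  proof (rule Bochner_Integration.integrable_bound)
    show "integrable M (\<lambda>\<omega>. 1 / \<theta>0 * exp (\<theta>0 * \<bar>y \<omega> - 0\<bar>))" using exp_int[of 0] by simp
    have "norm (y \<omega>) \<le> norm (1 / \<theta>0 * exp (\<theta>0 * \<bar>y \<omega> - 0\<bar>))" for \<omega>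
    proof -
      have "\<theta>0 * \<bar>y \<omega>\<bar> \<le> exp (\<theta>0 * \<bar>y \<omega>\<bar>)" using exp_ge_add_one_self[of "\<theta>0 * \<bar>y \<omega>\<bar>"] by linarith
      then show ?thesis using \<theta>0 by (simp add: field_simps)
    qed
    then show "AE \<omega> in M. norm (y \<omega>) \<le> norm (1 / \<theta>0 * exp (\<theta>0 * \<bar>y \<omega> - 0\<bar>))" by simp
  qed measurable
  have "ext_expectation M (?best L) = ereal (expectation y)"
  proof -
    have a: "(\<integral>\<^sup>+\<omega>. e2ennreal (?best L \<omega>) \<partial>M) = (\<integral>\<^sup>+\<omega>. ennreal (y \<omega>) \<partial>M)"
      by (rule nn_integral_cong_AE, use AE_y in eventually_elim) simp
    have b: "(\<integral>\<^sup>+\<omega>. e2ennreal (- ?best L \<omega>) \<partial>M) = (\<integral>\<^sup>+\<omega>. ennreal (- y \<omega>) \<partial>M)"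
      by (rule nn_integral_cong_AE, use AE_y in eventually_elim) simp
    obtain u v where "(\<integral>\<^sup>+\<omega>. ennreal (y \<omega>) \<partial>M) = ennreal u" "(\<integral>\<^sup>+\<omega>. ennreal (- y \<omega>) \<partial>M) = ennreal v" "u \<ge> 0" "v \<ge> 0"
      using y_int unfolding real_integrable_def by (metis ennreal_cases infinity_ennreal_def)
    then show ?thesis
      unfolding ext_expectation_def a b real_lebesgue_integral_def[OF y_int] by simp
  qed
  with L(2) have drift: "expectation y > F" by simp
  \<comment> \<open>Half of the surplus becomes the guaranteed growth rate of the slope; the other
    half remains as a positive mean.\<close>
  define \<beta> where "\<beta> = (expectation y - F) / 2"
  have "expectation (\<lambda>\<omega>. y \<omega> - (F + \<beta>)) = expectation y - (F + \<beta>)"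
    using y_int by (simp add: prob_space)
  with drift have pos: "expectation (\<lambda>\<omega>. y \<omega> - (F + \<beta>)) > 0" by (simp add: \<beta>_def field_simps)
  obtain t where t: "t > 0" "integrable M (\<lambda>\<omega>. exp (- t * (y \<omega> - (F + \<beta>))))"
      "expectation (\<lambda>\<omega>. exp (- t * (y \<omega> - (F + \<beta>)))) < 1"
    by (rule ex_exp_moment_less_one[OF _ exp_int \<theta>0(1) pos]) measurable
  have "(\<integral>\<^sup>+\<omega>. exp_weight t (F + \<beta>) (?best L \<omega>) \<partial>M) = (\<integral>\<^sup>+\<omega>. ennreal (exp (- t * (y \<omega> - (F + \<beta>)))) \<partial>M)"
    by (rule nn_integral_cong_AE, use AE_y in eventually_elim) (simp add: exp_weight_def algebra_simps)
  also have "\<dots> = ennreal (expectation (\<lambda>\<omega>. exp (- t * (y \<omega> - (F + \<beta>)))))"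
    by (rule nn_integral_eq_integral[OF t(2)]) simp
  finally have w: "(\<integral>\<^sup>+\<omega>. exp_weight t (F + \<beta>) (?best L \<omega>) \<partial>M) = ennreal (expectation (\<lambda>\<omega>. exp (- t * (y \<omega> - (F + \<beta>)))))" .
  show thesis
    by (rule that[of \<beta> t "expectation (\<lambda>\<omega>. exp (- t * (y \<omega> - (F + \<beta>))))" c, OF _ t(1) _ t(3) _ w])
      (use drift c in \<open>auto simp: \<beta>_def p_def\<close>)
qed

section \<open>The walker\<close>

text \<open>Taking the least maximizer makes the choice measurable. For best score -\<infinity> it
  is 0.\<close>

definition best_index :: "int \<Rightarrow> (nat \<Rightarrow> ereal) \<Rightarrow> nat" where
  "best_index L z = (LEAST m. best_score L z \<le> score L z m)"

text \<open>Scores are at most \<open>L - m\<close>, so only finitely many exceed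
  \<open>x - 1\<close>, where \<open>x\<close> is the supremum; the largest of these attains
  it.\<close>

lemma score_best_index:
  assumes "best_score L z \<noteq> -\<infinity>"
  shows "score L z (best_index L z) = best_score L z"
proof -
  obtain x where x: "best_score L z = ereal x"
    using assms best_score_le[of L z] by (cases "best_score L z") auto
  define S where "S = {m. ereal (x - 1) < score L z m}"
  have "ereal (x - 1) < (SUP m. score L z m)" using x by (simp add: best_score_def)
  then have "S \<noteq> {}" unfolding less_SUP_iff S_def by auto
  moreover have "finite S"
  proof (rule finite_subset)
    show "S \<subseteq> {..nat \<lceil>real_of_int L - x + 1\<rceil>}"
    proof
      fix m assume "m \<in> S"
      then have "ereal (x - 1) < ereal (real_of_int L - real m)"
        unfolding S_def using score_le[of L z m] by (simp del: less_ereal.simps)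
      then show "m \<in> {..nat \<lceil>real_of_int L - x + 1\<rceil>}" by (simp add: le_nat_iff) linarith
    qed
  qed simp
  ultimately have "Max (score L z ` S) \<in> score L z ` S" by (intro Max_in) auto
  then obtain m where m: "m \<in> S" "Max (score L z ` S) = score L z m" by auto
  have "score L z k \<le> score L z m" for k
  proof (cases "k \<in> S")
    case False
    then show ?thesis using m(1) by (auto simp: S_def)
  next
    case True
    then show ?thesis using \<open>finite S\<close> by (simp flip: m(2))
  qed
  then have "best_score L z \<le> score L z m"
    unfolding best_score_def by (intro SUP_least) auto
  then have "best_score L z \<le> score L z (best_index L z)" unfolding best_index_def by (rule LeastI)
  then show ?thesis by (intro antisym score_le_best_score)
qed

text \<open>
  The state of the walker on entering a column is the pair of the proposed height (the previous
  height plus the slope) and the slope.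
\<close>

definition walker_step :: "int \<Rightarrow> int \<Rightarrow> int \<times> int \<Rightarrow> (int \<Rightarrow> ereal) \<Rightarrow> int \<times> int" where
  "walker_step L F y col =
    (let z = (\<lambda>m. col (fst y - int m)); s = snd y + \<lfloor>real_of_ereal (best_score L z)\<rfloor> - F
     in (fst y - int (best_index L z) + s, s))"

text \<open>With \<open>a = F + \<beta>\<close> and a finite best score this is the exponential of
  \<theta> times \<beta> minus the slope increment. Products over columns therefore measure how far
  the slope lags behind linear growth at rate \<beta>.\<close>

definition walker_weight :: "int \<Rightarrow> real \<Rightarrow> real \<Rightarrow> int \<times> int \<Rightarrow> (int \<Rightarrow> ereal) \<Rightarrow> ennreal" where
  "walker_weight L \<theta> a y col = exp_weight \<theta> a (best_score L (\<lambda>m. col (fst y - int m)))"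

text \<open>The indices are shifted: height 0 is the prescribed start, whose column is not among the
  inputs, and height \<open>Suc k\<close> is chosen in column \<open>col k\<close>.\<close>

primrec walker_height :: "int \<Rightarrow> int \<Rightarrow> int \<Rightarrow> int \<Rightarrow> (nat \<Rightarrow> int \<Rightarrow> ereal) \<Rightarrow> nat \<Rightarrow> int" where
  "walker_height L F h s col 0 = h"
| "walker_height L F h s col (Suc k) =
    (let u = fst (adaptive_state (walker_step L F) (h + s, s) col k)
     in u - int (best_index L (\<lambda>m. col k (u - int m))))"

abbreviation column_space :: "(int \<Rightarrow> ereal) measure" where
  "column_space \<equiv> PiM UNIV (\<lambda>_. count_space int_minf)"

lemma borel_measurable_column[measurable]: "(\<lambda>col. col j) \<in> borel_measurable column_space"
  using measurable_component_singleton[of j UNIV "\<lambda>_. count_space int_minf"]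
    measurable_int_minf_subset_borel by blast

lemma measurable_walker_step: "walker_step L F y \<in> measurable column_space (count_space UNIV)"
proof -
  define z :: "(int \<Rightarrow> ereal) \<Rightarrow> nat \<Rightarrow> ereal" where "z col m = col (fst y - int m)" for col m
  have best[measurable]: "(\<lambda>col. best_score L (z col)) \<in> borel_measurable column_space"
    unfolding z_def by measurable
  have score: "(\<lambda>col. score L (z col) m) \<in> borel_measurable column_space" for m
    unfolding z_def score_def by measurable
  define x where "x col = \<lfloor>real_of_ereal (best_score L (z col))\<rfloor>" for col
  have x: "x \<in> measurable column_space (count_space UNIV)"
    unfolding x_def by measurable
  define b where "b col = best_index L (z col)" for col
  have b: "b \<in> measurable column_space (count_space UNIV)"
    unfolding b_def best_index_def
    by (intro measurable_Least) (unfold pred_def, rule borel_measurable_le[OF best score])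
  define g where "g m k = (fst y - int m + (snd y + k - F), snd y + k - F)" for m k
  have "(\<lambda>col. g m (x col)) \<in> measurable column_space (count_space UNIV)" for m
    by (rule measurable_compose[OF x]) simp
  then have "(\<lambda>col. g (b col) (x col)) \<in> measurable column_space (count_space UNIV)"
    by (rule measurable_compose_countable) (rule b)
  then show ?thesis
    by (simp add: walker_step_def[abs_def] Let_def g_def b_def x_def z_def[abs_def])
qed

lemma measurable_walker_weight: "walker_weight L \<theta> a y \<in> borel_measurable column_space"
  unfolding walker_weight_def[abs_def] by measurable

section \<open>Pathwise consequences of bounded weight products\<close>

context
  fixes L F h s :: int and col :: "nat \<Rightarrow> int \<Rightarrow> ereal" and \<theta> \<beta> K :: real
  assumes pos: "\<theta> > 0" "\<beta> > 0" "K > 0"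
    and range: "\<And>k j. col k j \<in> int_minf"
    and bound: "\<And>n. (\<Prod>k<n. walker_weight L \<theta> (real_of_int F + \<beta>)
      (adaptive_state (walker_step L F) (h + s, s) col k) (col k)) \<le> ennreal K"
begin

private abbreviation "state \<equiv> adaptive_state (walker_step L F) (h + s, s) col"
private abbreviation "hgt \<equiv> walker_height L F h s col"
private abbreviation "slope k \<equiv> snd (state k)"
private abbreviation "proposal k \<equiv> fst (state k)"
private abbreviation "zs k \<equiv> (\<lambda>m. col k (proposal k - int m))"
private abbreviation "index k \<equiv> best_index L (zs k)"

text \<open>The best index \<open>m\<close> attains the score \<open>min a L - m\<close>, where
  \<open>a\<close> is the value of the column at the chosen height, and this equals the slope
  increment plus \<open>F\<close>. Bounding the minimum by \<open>a\<close> or by \<open>L\<close>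
  gives the two inequalities.\<close>

private lemma slope_Suc:
  assumes "best_score L (zs k) \<noteq> -\<infinity>"
  shows "best_score L (zs k) = ereal (real_of_int (slope (Suc k) - slope k + F))"
    and "ereal (real_of_int (slope (Suc k) - slope k + F + int (index k))) \<le> col k (hgt (Suc k))"
    and "int (index k) \<le> L - F - (slope (Suc k) - slope k)"
proof -
  let ?m = "index k"
  have eq: "best_score L (zs k) = min (col k (hgt (Suc k))) (ereal (real_of_int L)) - ereal (real ?m)"
    using score_best_index[OF assms] by (simp add: score_def Let_def)
  with assms have "col k (hgt (Suc k)) \<noteq> -\<infinity>" by auto
  then obtain a where a: "col k (hgt (Suc k)) = ereal (real_of_int a)"
    using range[of k "hgt (Suc k)"] by (auto simp: int_minf_def)
  have eq': "best_score L (zs k) = ereal (real_of_int (min a L - int ?m))"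
    unfolding eq a by (simp add: min_def)
  \<comment> \<open>A finite best score is already an integer, so the floor only changes its
    type.\<close>
  have "\<lfloor>real_of_ereal (best_score L (zs k))\<rfloor> = min a L - int ?m"
    unfolding eq' real_of_ereal.simps by (rule floor_of_int)
  then have step: "slope (Suc k) - slope k + F = min a L - int ?m"
    by (simp add: walker_step_def Let_def)
  show "best_score L (zs k) = ereal (real_of_int (slope (Suc k) - slope k + F))"
    unfolding step eq' ..
  show "ereal (real_of_int (slope (Suc k) - slope k + F + int ?m)) \<le> col k (hgt (Suc k))"
    unfolding step a by simp
  show "int ?m \<le> L - F - (slope (Suc k) - slope k)" using step by linarith
qed

text \<open>The exponents telescope. Both claims share one induction: the formula needs finite best
  scores, and a best score of -\<infinity> would make the product infinite, against
  \<open>bound\<close>.\<close>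

private lemma weight_eq:
  "(\<Prod>k<n. walker_weight L \<theta> (real_of_int F + \<beta>) (state k) (col k))
      = ennreal (exp (\<theta> * (real n * \<beta> - real_of_int (slope n - s))))
    \<and> (\<forall>k<n. best_score L (zs k) \<noteq> -\<infinity>)"
proof (induction n)
  case 0
  show ?case by simp
next
  case (Suc n)
  let ?e = "exp (\<theta> * (real n * \<beta> - real_of_int (slope n - s)))"
  have prod: "(\<Prod>k<Suc n. walker_weight L \<theta> (real_of_int F + \<beta>) (state k) (col k))
      = ennreal ?e * exp_weight \<theta> (real_of_int F + \<beta>) (best_score L (zs n))"
    using Suc.IH by (simp add: walker_weight_def)
  have fin: "best_score L (zs n) \<noteq> -\<infinity>"
  proof
    assume "best_score L (zs n) = -\<infinity>"
    then have "ennreal ?e * exp_weight \<theta> (real_of_int F + \<beta>) (best_score L (zs n)) = \<infinity>"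
      by (simp add: exp_weight_def ennreal_mult_top)
    then show False using bound[of "Suc n"] unfolding prod by (simp add: top_unique)
  qed
  have "ennreal ?e * exp_weight \<theta> (real_of_int F + \<beta>) (best_score L (zs n))
    = ennreal (?e * exp (\<theta> * (\<beta> - real_of_int (slope (Suc n) - slope n))))"
    unfolding slope_Suc(1)[OF fin] by (simp add: exp_weight_def ennreal_mult algebra_simps)
  also have "?e * exp (\<theta> * (\<beta> - real_of_int (slope (Suc n) - slope n)))
    = exp (\<theta> * (real (Suc n) * \<beta> - real_of_int (slope (Suc n) - s)))"
    by (simp add: algebra_simps flip: exp_add)
  finally show ?case unfolding prod using Suc.IH fin by (auto simp: less_Suc_eq)
qed

private lemma best_score_finite: "best_score L (zs k) \<noteq> -\<infinity>"
  using weight_eq[of "Suc k"] by blast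

private lemma slope_ge: "real_of_int (slope n) \<ge> s + real n * \<beta> - ln K / \<theta>"
proof -
  have "exp (\<theta> * (real n * \<beta> - real_of_int (slope n - s))) \<le> K"
    using bound[of n] weight_eq[of n] pos by simp
  then have "\<theta> * (real n * \<beta> - real_of_int (slope n - s)) \<le> ln K"
    using pos by (simp add: ln_ge_iff)
  then have "real n * \<beta> - real_of_int (slope n - s) \<le> ln K / \<theta>" using pos by (simp add: field_simps)
  then show ?thesis by simp
qed

private lemma proposal_eq: "proposal k = hgt k + slope k"
  by (cases k) (simp_all add: walker_step_def Let_def)

private lemma height_Suc: "hgt (Suc k) = hgt k + slope k - int (index k)"
  using proposal_eq[of k] by (simp add: Let_def)

lemma walker_height_1_le: "walker_height L F h s col 1 \<le> h + s"
  by (simp add: Let_def)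

text \<open>The second difference is the slope increment plus \<open>index k\<close> minus
  \<open>index (Suc k)\<close>. The last term is dropped, and the rest is covered by the column
  value at the chosen height.\<close>

lemma walker_height_laplacian_le:
  "ereal (real_of_int (walker_height L F h s col (Suc (Suc k)) + walker_height L F h s col k
      - 2 * walker_height L F h s col (Suc k)))
    \<le> col k (walker_height L F h s col (Suc k)) - ereal (real_of_int F)"
proof -
  have "hgt (Suc (Suc k)) + hgt k - 2 * hgt (Suc k) \<le> slope (Suc k) - slope k + int (index k)"
    using height_Suc[of k] height_Suc[of "Suc k"] by linarith
  then have "ereal (real_of_int (hgt (Suc (Suc k)) + hgt k - 2 * hgt (Suc k)))
    \<le> ereal (real_of_int (slope (Suc k) - slope k + F + int (index k))) - ereal (real_of_int F)"
    by simp
  also have "\<dots> \<le> col k (hgt (Suc k)) - ereal (real_of_int F)"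
    by (intro ereal_minus_mono slope_Suc(2)[OF best_score_finite]) simp
  finally show ?thesis .
qed

text \<open>The height increment out of index \<open>k\<close> is at least
  \<open>(k + 1) * \<beta> - A\<close>, so the heights dominate a quadratic in \<open>n\<close>;
  completing the square bounds it below by \<open>h - A\<^sup>2 / (2 * \<beta>)\<close>.\<close>

lemma walker_height_nonneg:
  assumes "(ln K / \<theta> + real_of_int (L - F - s))\<^sup>2 / (2 * \<beta>) \<le> real_of_int h"
  shows "walker_height L F h s col n \<ge> 0"
proof -
  define A where "A = ln K / \<theta> + real_of_int (L - F - s)"
  have "real_of_int (hgt n) \<ge> h + \<beta> * real n * (real n + 1) / 2 - A * real n"
  proof (induction n)
    case (Suc n)
    \<comment> \<open>The bound on the index contains the slope increment, which turns the current
      slope into the next one.\<close>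
    have "hgt (Suc n) \<ge> hgt n + slope (Suc n) - (L - F)"
      using height_Suc[of n] slope_Suc(3)[OF best_score_finite, of n] by linarith
    then have "real_of_int (hgt (Suc n)) \<ge> real_of_int (hgt n) + real_of_int (slope (Suc n)) - real_of_int (L - F)"
      by linarith
    moreover have "real_of_int (slope (Suc n)) - real_of_int (L - F) \<ge> real (Suc n) * \<beta> - A"
      using slope_ge[of "Suc n"] by (simp add: A_def)
    ultimately show ?case using Suc.IH by (simp add: field_simps)
  qed simp
  moreover have "(\<beta> * real n - A)\<^sup>2 / (2 * \<beta>) \<ge> 0" using pos by simp
  then have "\<beta> * (real n)\<^sup>2 / 2 - A * real n + A\<^sup>2 / (2 * \<beta>) \<ge> 0"
    using pos by (simp add: power2_eq_square field_simps)
  moreover have "\<beta> * real n * (real n + 1) / 2 \<ge> \<beta> * (real n)\<^sup>2 / 2"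
    using pos by (simp add: power2_eq_square field_simps)
  ultimately have "real_of_int (hgt n) \<ge> 0" using assms unfolding A_def[symmetric] by linarith
  then show ?thesis by simp
qed

end

section \<open>Independence and joint laws of columns\<close>

lemma (in prob_space) indep_vars_reindex_inj:
  assumes ind: "indep_vars M' X I" and g: "inj_on g J" "g ` J \<subseteq> I"
  shows "indep_vars (\<lambda>j. M' (g j)) (\<lambda>j. X (g j)) J"
proof -
  have "indep_vars (\<lambda>j. PiM {g j} M') (\<lambda>j \<omega>. restrict (\<lambda>i. X i \<omega>) {g j}) J"
    by (rule indep_vars_restrict[OF ind]) (use g in \<open>auto simp: disjoint_family_on_def inj_on_def\<close>)
  then have "indep_vars (\<lambda>j. M' (g j)) (\<lambda>j \<omega>. (restrict (\<lambda>i. X i \<omega>) {g j}) (g j)) J"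
    by (rule indep_vars_compose2[where Y="\<lambda>j h. h (g j)"]) (rule measurable_component_singleton, simp)
  then show ?thesis by simp
qed

text \<open>Distinct columns occupy disjoint blocks of indices; each block is then read as a
  function of the height alone.\<close>

lemma (in prob_space) indep_vars_columns:
  fixes f :: "int \<Rightarrow> int \<Rightarrow> 'a \<Rightarrow> ereal" and c :: "nat \<Rightarrow> int"
  assumes ind: "indep_vars (\<lambda>_. count_space int_minf) (\<lambda>(i, j). f i j) UNIV" and "inj c"
  shows "indep_vars (\<lambda>_. column_space) (\<lambda>k \<omega> j. f (c k) j \<omega>) UNIV"
proof -
  let ?K = "\<lambda>k. {c k} \<times> (UNIV :: int set)"
  have "indep_vars (\<lambda>k. PiM (?K k) (\<lambda>_. count_space int_minf))
      (\<lambda>k \<omega>. restrict (\<lambda>i. (\<lambda>(i, j). f i j) i \<omega>) (?K k)) UNIV"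
    by (rule indep_vars_restrict[OF ind]) (use \<open>inj c\<close> in \<open>auto simp: disjoint_family_on_def inj_def\<close>)
  then have "indep_vars (\<lambda>_. column_space)
      (\<lambda>k \<omega>. (\<lambda>j. (restrict (\<lambda>i. (\<lambda>(i, j). f i j) i \<omega>) (?K k)) (c k, j))) UNIV"
    by (rule indep_vars_compose2[where Y="\<lambda>k h j. h (c k, j)"])
      (auto intro!: measurable_abs_UNIV measurable_component_singleton)
  then show ?thesis by simp
qed

text \<open>Both joint laws are the infinite power of \<open>D\<close>. This carries integrals of
  functions of \<open>Z\<close> on one probability space over to the environment on the
  other.\<close>

lemma distr_iid_eq:
  fixes X :: "'i \<Rightarrow> 'a \<Rightarrow> 'c" and Y :: "'i \<Rightarrow> 'b \<Rightarrow> 'c"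
  assumes M: "prob_space M" "prob_space.indep_vars M (\<lambda>_. C) X UNIV" "\<And>i. distr M C (X i) = D"
    and N: "prob_space N" "prob_space.indep_vars N (\<lambda>_. C) Y UNIV" "\<And>i. distr N C (Y i) = D"
  shows "distr M (PiM UNIV (\<lambda>_. C)) (\<lambda>\<omega> i. X i \<omega>) = distr N (PiM UNIV (\<lambda>_. C)) (\<lambda>\<omega> i. Y i \<omega>)"
proof -
  have *: "distr P (PiM UNIV (\<lambda>_. C)) (\<lambda>\<omega> i. W i \<omega>) = PiM UNIV (\<lambda>_. D)"
    if "prob_space P" "prob_space.indep_vars P (\<lambda>_. C) W UNIV" "\<And>i. distr P C (W i) = D"
    for P :: "'p measure" and W :: "'i \<Rightarrow> 'p \<Rightarrow> 'c"
  proof -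
    interpret P: prob_space P by fact
    have rv: "W i \<in> measurable P C" for i using that(2) by (auto simp: P.indep_vars_def)
    show ?thesis
      using P.indep_vars_iff_distr_eq_PiM[where M'="\<lambda>_. C" and X=W and I=UNIV, OF _ rv] that(2,3)
      by (simp add: restrict_def)
  qed
  show ?thesis using *[OF M] *[OF N] by simp
qed

section \<open>Gluing two walkers\<close>

text \<open>The exceptional sets for \<epsilon> = 1/(n+1) intersect in a null set that covers all
  failures of \<open>P\<close>, whether or not these form a measurable set.\<close>

lemma (in prob_space) AE_I_prob_small:
  assumes "\<And>\<epsilon>. \<epsilon> > 0 \<Longrightarrow> \<exists>B \<in> sets M. prob B \<le> \<epsilon> \<and> (\<forall>\<omega> \<in> space M - B. P \<omega>)"
  shows "AE \<omega> in M. P \<omega>"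
proof -
  have "\<forall>n. \<exists>B. B \<in> sets M \<and> prob B \<le> inverse (real (Suc n)) \<and> (\<forall>\<omega> \<in> space M - B. P \<omega>)"
    using assms[of "inverse (real (Suc _))"] by (auto simp: Bex_def)
  then obtain B where B: "\<And>n. B n \<in> sets M" "\<And>n. prob (B n) \<le> inverse (real (Suc n))"
    "\<And>n \<omega>. \<omega> \<in> space M - B n \<Longrightarrow> P \<omega>" by metis
  have sets: "(\<Inter>n. B n) \<in> sets M" using B(1) by auto
  have "prob (\<Inter>n. B n) \<le> inverse (real (Suc n))" for n
    by (rule order_trans[OF finite_measure_mono B(2)]) (use B(1) in auto)
  then have "prob (\<Inter>n. B n) \<le> 0"
    using LIMSEQ_le_const[OF LIMSEQ_inverse_real_of_nat] by blast
  then have "prob (\<Inter>n. B n) = 0" by (intro antisym measure_nonneg)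
  then have "emeasure M (\<Inter>n. B n) = 0" by (simp add: emeasure_eq_measure)
  then show ?thesis
    by (rule AE_I[OF _ _ sets, rotated]) (use B(3) in auto)
qed

theorem corollary2p3:
  fixes M :: "'a measure" and N :: "'b measure"
    and f :: "int \<Rightarrow> int \<Rightarrow> 'a \<Rightarrow> ereal"
    and Z :: "nat \<Rightarrow> 'b \<Rightarrow> ereal"
    and F :: int
  assumes "prob_space M"
    and "prob_space.indep_vars M (\<lambda>_. count_space int_minf) (\<lambda>(i, j). f i j) UNIV"
    and "\<And>i j. distr M (count_space int_minf) (f i j) = distr M (count_space int_minf) (f 0 0)"
    and "prob_space N"
    and "prob_space.indep_vars N (\<lambda>_. count_space int_minf) Z UNIV"
    and "\<And>m. distr N (count_space int_minf) (Z m) = distr M (count_space int_minf) (f 0 0)"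
    and "ext_expectation_defined N (\<lambda>\<omega>. SUP m. Z m \<omega> - ereal (real m))"
    and "ext_expectation N (\<lambda>\<omega>. SUP m. Z m \<omega> - ereal (real m)) > ereal (real_of_int F)"
  shows "AE \<omega> in M. \<exists>v :: int \<Rightarrow> nat. \<forall>i.
           ereal (real_of_int (laplacian1 (\<lambda>k. int (v k)) i))
             \<le> f i (int (v i)) \<omega> - ereal (real_of_int F)"
proof -
  interpret M: prob_space M by fact
  interpret N: prob_space N by fact
  define D where "D = distr M (count_space int_minf) (f 0 0)"
  obtain L c :: int and \<beta> \<theta> r :: real where pos: "\<beta> > 0" "\<theta> > 0" and r: "0 \<le> r" "r < 1"
    and q: "measure D {x \<in> int_minf. x < ereal (real_of_int c)} < 1" (is "?q < 1")
    and wt: "(\<integral>\<^sup>+\<omega>. exp_weight \<theta> (real_of_int F + \<beta>) (best_score L (\<lambda>m. Z m \<omega>)) \<partial>N) = ennreal r"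
    by (rule N.ex_exponential_drift[OF assms(5) assms(6)[folded D_def] assms(8)])
  have rv: "f i j \<in> measurable M (count_space int_minf)" for i j
    using assms(2) by (auto simp: M.indep_vars_def)
  have [measurable]: "f i j \<in> borel_measurable M" for i j
    using rv measurable_int_minf_subset_borel by blast
  have Zrv: "Z m \<in> measurable N (count_space int_minf)" for m
    using assms(5) by (auto simp: N.indep_vars_def)
  have f_range: "f i j \<omega> \<in> int_minf" if "\<omega> \<in> space M" for i j \<omega>
    using measurable_space[OF rv that] by simp
  have f_indep: "M.indep_vars (\<lambda>_. count_space int_minf) (\<lambda>m::nat. f i (g m)) UNIV" if "inj g" for i g
  proof -
    have "inj (\<lambda>m. (i, g m))" using that by (auto simp: inj_def)
    from M.indep_vars_reindex_inj[OF assms(2) this] show ?thesis by simp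
  qed
  \<comment> \<open>Read downwards from the proposed height, a column is an iid sequence with the
    joint law of \<open>Z\<close>, so the moment is the same for every state and column.\<close>
  have weight: "(\<integral>\<^sup>+\<omega>. walker_weight L \<theta> (real_of_int F + \<beta>) y (\<lambda>j. f i j \<omega>) \<partial>M) \<le> ennreal r" for y i
  proof -
    let ?C = "PiM (UNIV :: nat set) (\<lambda>_. count_space int_minf)"
    let ?g = "\<lambda>z. exp_weight \<theta> (real_of_int F + \<beta>) (best_score L z)"
    let ?X = "\<lambda>m::nat. f i (fst y - int m)"
    have [measurable]: "(\<lambda>z. z m) \<in> borel_measurable ?C" for m
      using measurable_component_singleton[of m UNIV "\<lambda>_. count_space int_minf"]
        measurable_int_minf_subset_borel by blast
    have [measurable]: "?g \<in> borel_measurable ?C" by measurable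
    have "(\<integral>\<^sup>+\<omega>. walker_weight L \<theta> (real_of_int F + \<beta>) y (\<lambda>j. f i j \<omega>) \<partial>M)
        = (\<integral>\<^sup>+z. ?g z \<partial>distr M ?C (\<lambda>\<omega> m. ?X m \<omega>))"
      by (subst nn_integral_distr) (auto simp: walker_weight_def intro!: measurable_abs_UNIV rv)
    also have "distr M ?C (\<lambda>\<omega> m. ?X m \<omega>) = distr N ?C (\<lambda>\<omega> m. Z m \<omega>)"
    proof (rule distr_iid_eq[where D=D])
      show "M.indep_vars (\<lambda>_. count_space int_minf) ?X UNIV"
        by (rule f_indep) (auto simp: inj_def)
    qed (use assms in \<open>auto simp: D_def\<close>)
    also have "(\<integral>\<^sup>+z. ?g z \<partial>distr N ?C (\<lambda>\<omega> m. Z m \<omega>)) = ennreal r"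
      unfolding wt[symmetric] by (subst nn_integral_distr) (auto intro!: measurable_abs_UNIV Zrv)
    finally show ?thesis by simp
  qed
  have prob_less: "M.prob {\<omega> \<in> space M. f i j \<omega> < ereal (real_of_int c)} = ?q" for i j
  proof -
    have "?q = M.prob (f i j -` {x \<in> int_minf. x < ereal (real_of_int c)} \<inter> space M)"
      unfolding D_def assms(3)[of i j, symmetric] by (subst measure_distr[OF rv]) auto
    also have "f i j -` {x \<in> int_minf. x < ereal (real_of_int c)} \<inter> space M
        = {\<omega> \<in> space M. f i j \<omega> < ereal (real_of_int c)}"
      using f_range by auto
    finally show ?thesis by simp
  qed
  \<comment> \<open>The event of the Chernoff bound along the columns enumerated by
    \<open>g\<close>; off this event the pathwise estimates apply.\<close>
  define bad where "bad g s K h = {\<omega> \<in> space M. \<exists>n. (\<Prod>k<n. walker_weight L \<theta> (real_of_int F + \<beta>)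
      (adaptive_state (walker_step L F) (h + s, s) (\<lambda>k j. f (g k) j \<omega>) k) (\<lambda>j. f (g k) j \<omega>)) > ennreal K}"
    for g :: "nat \<Rightarrow> int" and s K h
  have bad: "bad g s K h \<in> sets M" "M.prob (bad g s K h) \<le> 1 / (K * (1 - r))" if "inj g" "K > 0" for g s K h
  proof -
    have "(\<integral>\<^sup>+\<omega>. walker_weight L \<theta> (real_of_int F + \<beta>) y (\<lambda>j. f (g k) j \<omega>) \<partial>M) \<le> ennreal r" for y k
      by (rule weight)
    note * = M.indep_vars_columns[OF assms(2) that(1)] measurable_walker_step[of L F]
      measurable_walker_weight[of L \<theta> "real_of_int F + \<beta>"] this r that(2)
    show "bad g s K h \<in> sets M"
      unfolding bad_def by (rule M.prob_adaptive_weight_gt_le(1)[where \<xi>="\<lambda>k \<omega> j. f (g k) j \<omega>", OF *])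
    show "M.prob (bad g s K h) \<le> 1 / (K * (1 - r))"
      unfolding bad_def by (rule M.prob_adaptive_weight_gt_le(2)[where \<xi>="\<lambda>k \<omega> j. f (g k) j \<omega>", OF *])
  qed
  \<comment> \<open>Both enumerations skip column 0, so input \<open>k\<close> is the column at
    distance \<open>k + 1\<close>, matching the index shift in \<open>walker_height\<close>.\<close>
  define gR where "gR k = 1 + int k" for k
  define gL where "gL k = - 1 - int k" for k
  have inj: "inj gR" "inj gL" by (auto simp: gR_def gL_def inj_def)
  \<comment> \<open>The initial slopes, \<open>c - F\<close> to the right and 0 to the left, sum to
    \<open>c - F\<close>. This bounds the Laplacian at column 0, and \<open>start\<close> allows
    it.\<close>
  have good: "\<exists>v :: int \<Rightarrow> nat. \<forall>i. ereal (real_of_int (laplacian1 (\<lambda>k. int (v k)) i))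
             \<le> f i (int (v i)) \<omega> - ereal (real_of_int F)"
    if \<omega>: "\<omega> \<in> space M" and K: "K > 0" and start: "ereal (real_of_int c) \<le> f 0 h \<omega>"
      and R: "\<omega> \<notin> bad gR (c - F) K h" "(ln K / \<theta> + real_of_int (L - F - (c - F)))\<^sup>2 / (2 * \<beta>) \<le> real_of_int h"
      and L: "\<omega> \<notin> bad gL 0 K h" "(ln K / \<theta> + real_of_int (L - F - 0))\<^sup>2 / (2 * \<beta>) \<le> real_of_int h"
    for \<omega> K h
  proof -
    define colR where "colR k j = f (gR k) j \<omega>" for k j
    define colL where "colL k j = f (gL k) j \<omega>" for k j
    define vR where "vR = walker_height L F h (c - F) colR"
    define vL where "vL = walker_height L F h 0 colL"
    have range: "colR k j \<in> int_minf" "colL k j \<in> int_minf" for k j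
      using f_range[OF \<omega>] by (auto simp: colR_def colL_def)
    have boundR: "(\<Prod>k<n. walker_weight L \<theta> (real_of_int F + \<beta>)
      (adaptive_state (walker_step L F) (h + (c - F), c - F) colR k) (colR k)) \<le> ennreal K" for n
      using R(1) \<omega> unfolding bad_def colR_def by (auto simp: not_less)
    have boundL: "(\<Prod>k<n. walker_weight L \<theta> (real_of_int F + \<beta>)
      (adaptive_state (walker_step L F) (h + 0, 0) colL k) (colL k)) \<le> ennreal K" for n
      using L(1) \<omega> unfolding bad_def colL_def by (auto simp: not_less)
    note R' = pos(2,1) K range(1) boundR and L' = pos(2,1) K range(2) boundL
    have R1: "vR 1 \<le> h + (c - F)" unfolding vR_def using R' by (rule walker_height_1_le)
    have L1: "vL 1 \<le> h + 0" unfolding vL_def using L' by (rule walker_height_1_le)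
    have Rlap: "ereal (real_of_int (vR (Suc (Suc k)) + vR k - 2 * vR (Suc k)))
        \<le> colR k (vR (Suc k)) - ereal (real_of_int F)" for k
      unfolding vR_def using R' by (rule walker_height_laplacian_le)
    have Llap: "ereal (real_of_int (vL (Suc (Suc k)) + vL k - 2 * vL (Suc k)))
        \<le> colL k (vL (Suc k)) - ereal (real_of_int F)" for k
      unfolding vL_def using L' by (rule walker_height_laplacian_le)
    have nonneg: "vR k \<ge> 0" "vL k \<ge> 0" for k
      unfolding vR_def vL_def
      using walker_height_nonneg[OF R' R(2)] walker_height_nonneg[OF L' L(2)] by auto
    have zero: "vR 0 = h" "vL 0 = h" by (simp_all add: vR_def vL_def)
    \<comment> \<open>Nonnegativity makes \<open>nat\<close> lossless, and the two halves agree at 0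
      because both start at \<open>h\<close>.\<close>
    define v where "v i = nat (if i \<ge> 0 then vR (nat i) else vL (nat (- i)))" for i :: int
    have vR: "int (v (int k)) = vR k" and vL: "int (v (- int k)) = vL k" for k
      using nonneg zero by (auto simp: v_def)
    have "ereal (real_of_int (laplacian1 (\<lambda>k. int (v k)) i)) \<le> f i (int (v i)) \<omega> - ereal (real_of_int F)" for i
    proof -
      consider "i = 0" | k where "i = int (Suc k)" | k where "i = - int (Suc k)"
        by (metis int_cases3 not0_implies_Suc of_nat_0_less_iff gr0_conv_Suc)
      then show ?thesis
      proof cases
        case 1
        have "laplacian1 (\<lambda>k. int (v k)) 0 = vR 1 + vL 1 - 2 * h"
          using vR[of 1] vL[of 1] vR[of 0] zero by (simp add: laplacian1_def)
        also have "\<dots> \<le> c - F" using R1 L1 by simp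
        finally have "ereal (real_of_int (laplacian1 (\<lambda>k. int (v k)) 0))
          \<le> ereal (real_of_int c) - ereal (real_of_int F)" by simp
        also have "\<dots> \<le> f 0 h \<omega> - ereal (real_of_int F)" by (intro ereal_minus_mono start) simp
        finally show ?thesis using 1 vR[of 0] zero by simp
      next
        case (2 k)
        have "i + 1 = int (Suc (Suc k))" "i - 1 = int k" using 2 by auto
        then have "laplacian1 (\<lambda>k. int (v k)) i = vR (Suc (Suc k)) + vR k - 2 * vR (Suc k)"
          unfolding laplacian1_def 2 by (simp only: vR)
        moreover have "f i (int (v i)) \<omega> = colR k (vR (Suc k))"
          unfolding 2 vR by (simp add: colR_def gR_def)
        ultimately show ?thesis using Rlap[of k] by simp
      next
        case (3 k)
        have "i - 1 = - int (Suc (Suc k))" "i + 1 = - int k" using 3 by auto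
        then have "laplacian1 (\<lambda>k. int (v k)) i = vL k + vL (Suc (Suc k)) - 2 * vL (Suc k)"
          unfolding laplacian1_def 3 by (simp only: vL)
        moreover have "f i (int (v i)) \<omega> = colL k (vL (Suc k))"
          unfolding 3 vL by (simp add: colL_def gL_def)
        ultimately show ?thesis using Llap[of k] by (simp add: add.commute)
      qed
    qed
    then show ?thesis by blast
  qed
  show ?thesis
  proof (rule M.AE_I_prob_small)
    fix \<epsilon> :: real assume \<epsilon>: "\<epsilon> > 0"
    have q0: "?q \<ge> 0" by simp
    \<comment> \<open>\<open>n\<close> candidate starting heights: the probability that all of them
      have value below \<open>c\<close> in column 0 is less than \<epsilon>/2.\<close>
    obtain n where n: "?q ^ n < \<epsilon> / 2" using real_arch_pow_inv[OF _ q] \<epsilon> by (metis half_gt_zero)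
    \<comment> \<open>Each bad event then has probability at most
      \<open>\<epsilon> / (4 * Suc n)\<close>, so the two for each of the \<open>n\<close>
      candidates cost at most \<epsilon>/2 in total. Using \<open>Suc n\<close> keeps
      \<open>K\<close> positive for \<open>n = 0\<close>.\<close>
    define K where "K = 4 * real (Suc n) / (\<epsilon> * (1 - r))"
    have K: "K > 0" using \<epsilon> r by (simp add: K_def)
    \<comment> \<open>Large enough for both nonnegativity criteria, which all higher starts
      \<open>H + t\<close> inherit.\<close>
    define H where "H = \<lceil>max ((ln K / \<theta> + real_of_int (L - F - (c - F)))\<^sup>2 / (2 * \<beta>))
      ((ln K / \<theta> + real_of_int (L - F - 0))\<^sup>2 / (2 * \<beta>))\<rceil>"
    have H: "(ln K / \<theta> + real_of_int (L - F - (c - F)))\<^sup>2 / (2 * \<beta>) \<le> real_of_int (H + int t)"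
      "(ln K / \<theta> + real_of_int (L - F - 0))\<^sup>2 / (2 * \<beta>) \<le> real_of_int (H + int t)" for t
    proof -
      have "max ((ln K / \<theta> + real_of_int (L - F - (c - F)))\<^sup>2 / (2 * \<beta>))
        ((ln K / \<theta> + real_of_int (L - F - 0))\<^sup>2 / (2 * \<beta>)) \<le> real_of_int H"
        unfolding H_def by (rule le_of_int_ceiling)
      also have "\<dots> \<le> real_of_int (H + int t)" by simp
      finally show "(ln K / \<theta> + real_of_int (L - F - (c - F)))\<^sup>2 / (2 * \<beta>) \<le> real_of_int (H + int t)"
        "(ln K / \<theta> + real_of_int (L - F - 0))\<^sup>2 / (2 * \<beta>) \<le> real_of_int (H + int t)" by simp_all
    qed
    define E where "E = {\<omega> \<in> space M. \<forall>t<n. f 0 (H + int t) \<omega> < ereal (real_of_int c)}"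
    \<comment> \<open>The union over all candidates \<open>t\<close> is removed later, since the
      candidate actually used depends on \<omega>.\<close>
    define U where "U t = bad gR (c - F) K (H + int t) \<union> bad gL 0 K (H + int t)" for t
    have sE: "E \<in> sets M" unfolding E_def by measurable
    have sU: "U t \<in> sets M" for t unfolding U_def using bad(1) inj K by auto
    have "M.indep_vars (\<lambda>_. count_space int_minf) (\<lambda>m::nat. f 0 (H + int m)) UNIV"
      by (rule f_indep) (auto simp: inj_def)
    then have "M.prob E \<le> ?q ^ n"
      unfolding E_def by (rule M.prob_all_less_le_power) (simp add: prob_less)
    then have pE: "M.prob E \<le> \<epsilon> / 2" using n by simp
    have pU: "M.prob (U t) \<le> \<epsilon> / (2 * real (Suc n))" for t
    proof -
      have "M.prob (U t) \<le> M.prob (bad gR (c - F) K (H + int t)) + M.prob (bad gL 0 K (H + int t))"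
        unfolding U_def by (rule measure_Un_le) (use bad(1) inj K in auto)
      also have "\<dots> \<le> 1 / (K * (1 - r)) + 1 / (K * (1 - r))"
        by (intro add_mono bad inj K)
      also have "K * (1 - r) = 4 * real (Suc n) / \<epsilon>" using r by (simp add: K_def)
      also have "1 / (4 * real (Suc n) / \<epsilon>) + 1 / (4 * real (Suc n) / \<epsilon>) = \<epsilon> / (2 * real (Suc n))"
        by (simp add: divide_simps del: of_nat_Suc)
      finally show ?thesis .
    qed
    show "\<exists>B\<in>sets M. M.prob B \<le> \<epsilon> \<and> (\<forall>\<omega>\<in>space M - B. \<exists>v :: int \<Rightarrow> nat. \<forall>i.
      ereal (real_of_int (laplacian1 (\<lambda>k. int (v k)) i)) \<le> f i (int (v i)) \<omega> - ereal (real_of_int F))"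
    proof (intro bexI conjI ballI)
      show "E \<union> (\<Union>t<n. U t) \<in> sets M" using sE sU by auto
      have "M.prob (E \<union> (\<Union>t<n. U t)) \<le> M.prob E + M.prob (\<Union>t<n. U t)"
        by (rule measure_Un_le) (use sE sU in auto)
      also have "M.prob (\<Union>t<n. U t) \<le> (\<Sum>t<n. M.prob (U t))"
        by (rule measure_UNION_le) (use sU in auto)
      also have "\<dots> \<le> (\<Sum>t<n. \<epsilon> / (2 * real (Suc n)))" by (intro sum_mono pU)
      also have "\<dots> \<le> \<epsilon> / 2" using \<epsilon> by (simp add: field_simps)
      finally show "M.prob (E \<union> (\<Union>t<n. U t)) \<le> \<epsilon>" using pE by simp
    next
      fix \<omega> assume \<omega>: "\<omega> \<in> space M - (E \<union> (\<Union>t<n. U t))"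
      then obtain t where t: "t < n" "ereal (real_of_int c) \<le> f 0 (H + int t) \<omega>"
        by (auto simp: E_def not_less)
      show "\<exists>v :: int \<Rightarrow> nat. \<forall>i. ereal (real_of_int (laplacian1 (\<lambda>k. int (v k)) i))
          \<le> f i (int (v i)) \<omega> - ereal (real_of_int F)"
        by (rule good[OF _ K t(2) _ H(1) _ H(2)]) (use \<omega> t(1) in \<open>auto simp: U_def\<close>)
    qed
  qed
qed

end
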